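(* The set $\mathcal{J}$ of all rational $\overline{\mathbb{E}}$-inner functions is not convex.
   Context: $\mathbb{D}$ is the open unit disc and $\mathbb{T}$ the unit circle in $\mathbb{C}$. The open tetrablock is $\mathbb{E}=\{(x_1,x_2,x_3)\in\mathbb{C}^3: 1-x_1z-x_2w+x_3zw\neq 0 \text{ whenever } |z|\le 1,|w|\le 1\}$, with closure $\overline{\mathbb{E}}$. Its distinguished boundary is $b\overline{\mathbb{E}}=\{x\in\mathbb{C}^3: x_1=\overline{x_2}x_3,\ |x_3|=1,\ |x_2|\le 1\}$. A rational $\overline{\mathbb{E}}$-inner function is a rational analytic map $x=(x_1,x_2,x_3):\mathbb{D}\to\overline{\mathbb{E}}$ (automatically continuous on $\overline{\mathbb{D}}$) that maps $\mathbb{T}$ into $b\overline{\mathbb{E}}$. Convexity is with respect to pointwise operations on $\mathbb{C}^3$-valued functions. *)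

theory Defs
  imports
    "HOL-Analysis.Analysis"
    "HOL-Computational_Algebra.Polynomial"
    "HOL-Library.Function_Algebras"
begin

text \<open>Pointwise real vector space structure on functions, so that the library predicate
  \<^const>\<open>convex\<close> applies to sets of functions.\<close>

instantiation "fun" :: (type, real_vector) real_vector
begin

definition scaleR_fun :: "real \<Rightarrow> ('a \<Rightarrow> 'b) \<Rightarrow> 'a \<Rightarrow> 'b"
  where "scaleR_fun r f = (\<lambda>x. r *\<^sub>R f x)"

instance
  by standard (simp_all add: scaleR_fun_def plus_fun_def scaleR_add_right scaleR_add_left)

end

definition tetrablock :: "(complex ^ 3) set"
  where "tetrablock =
    {x. \<forall>z w. norm z \<le> 1 \<longrightarrow> norm w \<le> 1 \<longrightarrow>
          1 - x $ 1 * z - x $ 2 * w + x $ 3 * z * w \<noteq> 0}"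

definition tetrablock_bdry :: "(complex ^ 3) set"
  where "tetrablock_bdry = {x. x $ 1 = cnj (x $ 2) * x $ 3 \<and> norm (x $ 3) = 1 \<and> norm (x $ 2) \<le> 1}"

definition rational_on :: "complex set \<Rightarrow> (complex \<Rightarrow> complex) \<Rightarrow> bool"
  where "rational_on S f \<longleftrightarrow>
    (\<exists>p q :: complex poly. q \<noteq> 0 \<and> (\<forall>z\<in>S. poly q z \<noteq> 0 \<longrightarrow> f z = poly p z / poly q z))"

text \<open>A function on the open unit disc is encoded as a total function that vanishes outside the
  disc; this is a linear bijection for the pointwise operations. The values on the unit circle are
  those of the continuous extension to the closed disc.\<close>

definition rational_tetra_inner :: "(complex \<Rightarrow> complex ^ 3) set"
  where "rational_tetra_inner =
    {x. (\<forall>z. z \<notin> ball 0 1 \<longrightarrow> x z = 0)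
      \<and> (\<forall>i. rational_on (ball 0 1) (\<lambda>z. x z $ i))
      \<and> (\<forall>i. (\<lambda>z. x z $ i) holomorphic_on ball 0 1)
      \<and> x ` ball 0 1 \<subseteq> closure tetrablock
      \<and> (\<exists>X. continuous_on (cball 0 1) X \<and> (\<forall>z\<in>ball 0 1. X z = x z)
             \<and> X ` sphere 0 1 \<subseteq> tetrablock_bdry)}"

end

theory Submission
  imports Defs
begin

text \<open>Constant maps already destroy convexity. For a unimodular \<open>c\<close> the point \<open>(0, 0, c)\<close> lies
  in the distinguished boundary of the tetrablock, so the constant map with this value is a rational
  inner function. The values \<open>c = 1\<close> and \<open>c = -1\<close> give two such maps whose midpoint is the
  zero map, and zero cannot be inner, because its third component does not have modulus one on the
  circle. So the obstruction is the same as for inner functions of one variable: the modulus-one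
  condition is not convex.\<close>

text \<open>The tetrablock contains the disc \<open>{(0, 0, c) | \<bar>c\<bar> < 1}\<close>, since there its defining
  expression is \<open>1 + c z w\<close>; continuity of \<open>c \<mapsto> (0, 0, c)\<close> carries this to the closures.\<close>

lemma axis_3_in_closure_tetrablock:
  assumes "norm c \<le> 1"
  shows "axis 3 c \<in> closure tetrablock"
proof -
  have "axis 3 c \<in> tetrablock" if c: "norm c < 1" for c :: complex
  proof -
    have "1 + c * z * w \<noteq> 0" if "norm z \<le> 1" "norm w \<le> 1" for z w
    proof
      assume "1 + c * z * w = 0"
      then have "norm (c * (z * w)) = 1"
        by (metis add_eq_0_iff mult.assoc norm_minus_cancel norm_one)
      moreover have "norm (z * w) \<le> 1"
        using that by (simp add: norm_mult mult_le_one)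
      then have "norm (c * (z * w)) \<le> norm c"
        by (simp add: norm_mult mult_left_le)
      ultimately show False using c by simp
    qed
    then show ?thesis by (simp add: tetrablock_def axis_def)
  qed
  then have "axis 3 ` ball (0::complex) 1 \<subseteq> closure tetrablock"
    using closure_subset[of tetrablock] by auto
  moreover have "continuous_on (closure (ball 0 1)) (\<lambda>c::complex. axis (3::3) c)"
    unfolding axis_def
  proof (rule continuous_on_vec_lambda)
    show "continuous_on (closure (ball 0 1)) (\<lambda>c::complex. if i = 3 then c else 0)" for i :: 3
      by (cases "i = 3") simp_all
  qed
  ultimately have "axis 3 ` closure (ball (0::complex) 1) \<subseteq> closure tetrablock"
    by (intro image_closure_subset) auto
  then show ?thesis using assms by auto
qed

lemma constant_in_rational_tetra_inner:
  assumes "v \<in> closure tetrablock" "v \<in> tetrablock_bdry"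
  shows "(\<lambda>z. if z \<in> ball 0 1 then v else 0) \<in> rational_tetra_inner"
proof -
  let ?x = "\<lambda>z::complex. if z \<in> ball 0 1 then v else 0"
  have "rational_on (ball 0 1) (\<lambda>z. ?x z $ i)" for i
    unfolding rational_on_def
    by (rule exI[of _ "[:v $ i:]"], rule exI[of _ 1]) simp
  moreover have "(\<lambda>z. ?x z $ i) holomorphic_on ball 0 1" for i
    by (rule holomorphic_transform[OF holomorphic_on_const[of "v $ i"]]) simp
  moreover have "\<exists>X. continuous_on (cball 0 1) X \<and> (\<forall>z\<in>ball 0 1. X z = ?x z)
      \<and> X ` sphere 0 1 \<subseteq> tetrablock_bdry"
    using assms(2) by (intro exI[of _ "\<lambda>_. v"]) auto
  ultimately show ?thesis
    using assms(1) unfolding rational_tetra_inner_def by auto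
qed

text \<open>The continuous extension of the zero map to the closed disc is zero by density, but the
  origin is not in the distinguished boundary.\<close>

lemma zero_not_in_rational_tetra_inner: "(\<lambda>_. 0) \<notin> rational_tetra_inner"
proof
  assume "(\<lambda>_. 0) \<in> rational_tetra_inner"
  then obtain X :: "complex \<Rightarrow> complex ^ 3"
    where X: "continuous_on (cball 0 1) X" "\<And>z. z \<in> ball 0 1 \<Longrightarrow> X z = 0"
      "X ` sphere 0 1 \<subseteq> tetrablock_bdry"
    unfolding rational_tetra_inner_def by auto
  have "X 1 = 0"
    by (rule continuous_constant_on_closure[of "ball 0 1"]) (use X in auto)
  moreover have "X 1 \<in> tetrablock_bdry"
    using X(3) by auto
  ultimately show False by (simp add: tetrablock_bdry_def)
qed

theorem lemma6p8:
  shows "\<not> convex rational_tetra_inner"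
proof
  assume convex: "convex rational_tetra_inner"
  define f :: "complex \<Rightarrow> complex \<Rightarrow> complex ^ 3"
    where "f c = (\<lambda>z. if z \<in> ball 0 1 then axis 3 c else 0)" for c
  have inner: "f c \<in> rational_tetra_inner" if "norm c = 1" for c
    unfolding f_def
    using that by (intro constant_in_rational_tetra_inner axis_3_in_closure_tetrablock)
      (simp_all add: tetrablock_bdry_def axis_def)
  have "(1/2) *\<^sub>R f 1 + (1/2) *\<^sub>R f (-1) \<in> rational_tetra_inner"
    by (rule convexD[OF convex]) (auto intro: inner)
  moreover have "(1/2) *\<^sub>R f 1 + (1/2) *\<^sub>R f (-1) = (\<lambda>_. 0)"
    by (auto simp: f_def scaleR_fun_def plus_fun_def fun_eq_iff vec_eq_iff axis_def)
  ultimately show False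
    using zero_not_in_rational_tetra_inner by simp
qed

end
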